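(* Let $K\in\mathbb{R}^{m\times n}$ be strictly stabilizing for $(A,B)$, let $\bar X=\bar X(K)$ be the stationary state covariance, and let $u=Kx$ be the stationary input. Let $F\in\mathbb{R}^{m\times m}$ be positive definite, $c>0$, $\varepsilon_u\in(0,1)$, let $X\in\mathbb{R}^{n\times n}$ be any symmetric matrix such that $X\succeq\bar X$, and put $Y:=KX$. Then the joint chance constraint $$\mathbf{P}\bigl[u^{\top}F^{-1}u\le c\bigr]\ge1-\varepsilon_u$$ is satisfied (i) in the case of a WSS disturbance, if $$\begin{bmatrix}\dfrac{c\,\varepsilon_u}{m}F & Y\\ Y^{\top}&X\end{bmatrix}\succeq0;$$ (ii) in the case of a NRM disturbance, if $$\begin{bmatrix}\dfrac{c}{\mathrm{chi}_m^{-1}(1-\varepsilon_u)}F & Y\\ Y^{\top}&X\end{bmatrix}\succeq0.$$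
   Context: Consider the discrete-time linear system $x_{t+1}=Ax_t+Bu_t+w_t$ with $A\in\mathbb{R}^{n\times n}$, $B\in\mathbb{R}^{n\times m}$, $(A,B)$ stabilizable, fixed initial condition $x_0\in\mathbb{R}^n$, and state feedback $u_t=Kx_t$. The disturbances $\{w_t\}$ are a white noise process with zero mean and common finite covariance $W=\mathbf{E}[w_tw_t^{\top}]\succ0$. The case "WSS" (wide-sense stationary) means that only these first two moments are specified; the case "NRM" means that in addition all $w_t$ are identically normally distributed. $K$ is strictly stabilizing if all eigenvalues of $A+BK$ have modulus less than $1$; then $\bar X(K)\succ0$ denotes the unique solution of $\bar X-(A+BK)\bar X(A+BK)^{\top}-W=0$. The stationary state $x$ is a random variable in $\mathbb{R}^n$ with mean $0$ and covariance $\bar X(K)$; in the WSS case its distribution is otherwise unspecified (the result is asserted for every such distribution), and in the NRM case $x\sim\mathcal{N}(0,\bar X(K))$. The stationary input is $u:=Kx$, with mean $0$ and covariance $K\bar X(K)K^{\top}$. $\mathrm{chi}_m:[0,\infty)\to[0,1]$ is the cumulative distribution function of the chi-squared distribution with $m$ degrees of freedom. $\succeq$ denotes the semidefinite ordering on symmetric matrices. *)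

theory Defs
  imports "HOL-Probability.Probability"
begin

definition psd :: "real^'n^'n \<Rightarrow> bool" where
  "psd M \<longleftrightarrow> transpose M = M \<and> (\<forall>v. 0 \<le> v \<bullet> (M *v v))"

definition pd :: "real^'n^'n \<Rightarrow> bool" where
  "pd M \<longleftrightarrow> transpose M = M \<and> (\<forall>v. v \<noteq> 0 \<longrightarrow> 0 < v \<bullet> (M *v v))"

definition block_matrix ::
  "real^'m^'m \<Rightarrow> real^'n^'m \<Rightarrow> real^'m^'n \<Rightarrow> real^'n^'n \<Rightarrow> real^('m + 'n)^('m + 'n)" where
  "block_matrix P Q R S = (\<chi> i j. case (i, j) of
       (Inl a, Inl b) \<Rightarrow> P $ a $ b
     | (Inl a, Inr b) \<Rightarrow> Q $ a $ b
     | (Inr a, Inl b) \<Rightarrow> R $ a $ b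
     | (Inr a, Inr b) \<Rightarrow> S $ a $ b)"

definition complex_eigenvalue :: "real^'n^'n \<Rightarrow> complex \<Rightarrow> bool" where
  "complex_eigenvalue M z \<longleftrightarrow>
     (\<exists>v :: complex^'n. v \<noteq> 0 \<and> map_matrix complex_of_real M *v v = z *s v)"

definition strictly_stabilizing :: "real^'n^'n \<Rightarrow> real^'m^'n \<Rightarrow> real^'n^'m \<Rightarrow> bool" where
  "strictly_stabilizing A B K \<longleftrightarrow> (\<forall>z. complex_eigenvalue (A + B ** K) z \<longrightarrow> cmod z < 1)"

definition stabilizable :: "real^'n^'n \<Rightarrow> real^'m^'n \<Rightarrow> bool" where
  "stabilizable A B \<longleftrightarrow> (\<exists>K. strictly_stabilizing A B K)"

text \<open>
  The discrete Lyapunov equation below has exactly one solution whenever \<open>K\<close> is strictly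
  stabilizing, and that solution is positive definite if \<open>W\<close> is; for other \<open>K\<close> the value is
  unspecified.
\<close>

definition stationary_cov ::
  "real^'n^'n \<Rightarrow> real^'m^'n \<Rightarrow> real^'n^'n \<Rightarrow> real^'n^'m \<Rightarrow> real^'n^'n" where
  "stationary_cov A B W K =
     (THE X. X - (A + B ** K) ** X ** transpose (A + B ** K) - W = 0)"

definition outer :: "real^'n \<Rightarrow> real^'n \<Rightarrow> real^'n^'n" where
  "outer v w = (\<chi> i j. v $ i * w $ j)"

definition has_mean :: "'s measure \<Rightarrow> ('s \<Rightarrow> real^'n) \<Rightarrow> real^'n \<Rightarrow> bool" where
  "has_mean M x \<mu> \<longleftrightarrow> has_bochner_integral M x \<mu>"

definition has_cov :: "'s measure \<Rightarrow> ('s \<Rightarrow> real^'n) \<Rightarrow> real^'n^'n \<Rightarrow> bool" where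
  "has_cov M x S \<longleftrightarrow>
     (let \<mu> = integral\<^sup>L M x
      in has_bochner_integral M (\<lambda>\<omega>. outer (x \<omega> - \<mu>) (x \<omega> - \<mu>)) S)"

text \<open>The non-degenerate normal distribution; only positive definite covariances are needed.\<close>

definition mvnormal_density :: "real^'n \<Rightarrow> real^'n^'n \<Rightarrow> real^'n \<Rightarrow> real" where
  "mvnormal_density \<mu> S v =
     exp (- ((v - \<mu>) \<bullet> (matrix_inv S *v (v - \<mu>))) / 2) / sqrt ((2 * pi) ^ CARD('n) * det S)"

definition normally_distributed ::
  "'s measure \<Rightarrow> ('s \<Rightarrow> real^'n) \<Rightarrow> real^'n \<Rightarrow> real^'n^'n \<Rightarrow> bool" where
  "normally_distributed M x \<mu> S \<longleftrightarrow>
     pd S \<and> distributed M lborel x (\<lambda>v. ennreal (mvnormal_density \<mu> S v))"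

text \<open>
  White noise means zero mean, common covariance \<open>W\<close>, and no correlation between different times;
  nothing beyond these first two moments is specified in the wide-sense stationary case.
\<close>

definition wss_disturbance :: "'s measure \<Rightarrow> (nat \<Rightarrow> 's \<Rightarrow> real^'n) \<Rightarrow> real^'n^'n \<Rightarrow> bool" where
  "wss_disturbance M w W \<longleftrightarrow>
     (\<forall>t. has_mean M (w t) 0) \<and>
     (\<forall>t. has_cov M (w t) W) \<and>
     (\<forall>s t. s \<noteq> t \<longrightarrow> has_bochner_integral M (\<lambda>\<omega>. outer (w s \<omega>) (w t \<omega>)) 0)"

definition nrm_disturbance :: "'s measure \<Rightarrow> (nat \<Rightarrow> 's \<Rightarrow> real^'n) \<Rightarrow> real^'n^'n \<Rightarrow> bool" where
  "nrm_disturbance M w W \<longleftrightarrow>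
     wss_disturbance M w W \<and> (\<forall>t. normally_distributed M (w t) 0 W)"

text \<open>The law of the sum of the squares of \<open>k\<close> independent standard normal variables.\<close>

definition chi_squared :: "nat \<Rightarrow> real measure" where
  "chi_squared k =
     distr (PiM {..<k} (\<lambda>_. std_normal_distribution)) borel (\<lambda>z. \<Sum>i<k. (z i)\<^sup>2)"

text \<open>
  Inverse of the distribution function restricted to \<open>[0, \<infinity>)\<close>, where, for \<open>k > 0\<close>, it is injective
  with range \<open>[0, 1)\<close>.
\<close>

definition chi_squared_quantile :: "nat \<Rightarrow> real \<Rightarrow> real" where
  "chi_squared_quantile k p = inv_into {0..} (cdf (chi_squared k)) p"

end

theory Submission
  imports Defs
begin

text \<open>
  The block inequality is a bound on the input covariance. Testing it on the vectors \<open>(v, - K\<^sup>T v)\<close>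
  gives \<open>K X K\<^sup>T \<preceq> a F\<close>, where \<open>a\<close> is the factor in front of \<open>F\<close> (lemma \<open>psd_block_matrix_bound\<close>). As \<open>Xbar \<preceq> X\<close>, the
  input covariance satisfies \<open>K Xbar K\<^sup>T \<preceq> a F\<close> as well. The two cases then differ only in how this bound on
  a covariance is turned into a bound on a probability.

  In the wide-sense stationary case \<open>u\<^sup>T F\<^bsup>-1\<^esup> u\<close> has expectation at most \<open>a m = c \<epsilon>\<close>, and Markov's inequality
  finishes the proof (lemma \<open>wss_chance_constraint\<close>).

  In the normal case the input may be degenerate, so the argument works with the state. Choose an
  \<open>Xbar\<close>-orthonormal basis of \<open>\<real>\<^sup>n\<close> that begins with a basis of the range of \<open>K\<^sup>T\<close>. The coordinates of the
  state along it are independent standard normal variables (lemma \<open>whitened_normal_coordinates\<close>), and the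
  input depends only on the first \<open>d \<le> m\<close> of them. Cauchy--Schwarz and the covariance bound show that
  \<open>u\<^sup>T F\<^bsup>-1\<^esup> u\<close> is at most \<open>a\<close> times the sum of the squares of these \<open>d\<close> coordinates (lemma
  \<open>quadratic_form_le_sum_squares\<close>). That sum is a chi-squared variable with \<open>d\<close> degrees of freedom, and with
  \<open>a = c / q\<close> it has to stay below the quantile \<open>q\<close>, which is at least as likely as for \<open>m\<close> degrees of freedom.
  That the quantile is a true preimage, and positive, rests on the continuity of the chi-squared
  distribution function.

  The Gaussian part needs Lebesgue integrals to change by a constant factor under an injective linear map.
  The value of the factor can be left open, because all measures compared are probability measures.
\<close>

section \<open>Bases orthonormal for a positive definite form\<close>

definition form_orthonormal :: "real^'n^'n \<Rightarrow> (real^'n) set \<Rightarrow> bool" where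
  "form_orthonormal P B \<longleftrightarrow> (\<forall>v\<in>B. \<forall>w\<in>B. v \<bullet> (P *v w) = (if v = w then 1 else 0))"

lemma form_orthonormal_empty [simp]: "form_orthonormal P {}"
  by (simp add: form_orthonormal_def)

lemma inner_matrix_transpose: "(x::real^'m) \<bullet> (A *v y) = (transpose A *v x) \<bullet> (y::real^'n)"
  by (metis dot_lmul_matrix transpose_matrix_vector)

lemma pd_symmetric: "pd P \<Longrightarrow> v \<bullet> (P *v w) = w \<bullet> (P *v v)"
  by (metis inner_commute inner_matrix_transpose pd_def)

lemma form_orthonormal_independent:
  assumes "form_orthonormal P B"
  shows "independent B"
proof
  assume "dependent B"
  then obtain v where v: "v \<in> B" "v \<in> span (B - {v})"
    by (auto simp: dependent_def)
  have "v \<bullet> (P *v w) = 0" if "w \<in> span (B - {v})" for w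
    using that
  proof (induction rule: span_induct_alt)
    case (step c y z)
    then show ?case
      using assms v by (auto simp: form_orthonormal_def matrix_vector_right_distrib inner_add_right
        matrix_vector_mult_scaleR)
  qed simp
  with v have "v \<bullet> (P *v v) = 0"
    by blast
  with v assms show False
    by (auto simp: form_orthonormal_def)
qed

text \<open>
  One Gram--Schmidt step for the inner product \<open>\<langle>v, w\<rangle> = v \<bullet> (P *v w)\<close>: a vector of \<open>T\<close> outside the span loses
  its components along \<open>B\<close> and is then normalized.
\<close>

lemma form_orthonormal_insert:
  assumes P: "pd P" and T: "subspace T" and B: "form_orthonormal P B" "B \<subseteq> T" "span B \<noteq> T"
  obtains b where "b \<in> T" "b \<notin> B" "form_orthonormal P (insert b B)"
proof -
  have fin: "finite B"
    using B form_orthonormal_independent independent_imp_finite by blast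
  have "span B \<subseteq> T"
    using B T by (simp add: span_minimal)
  then obtain t where t: "t \<in> T" "t \<notin> span B"
    using B by blast
  define p where "p = (\<Sum>b\<in>B. (b \<bullet> (P *v t)) *\<^sub>R b)"
  define r where "r = t - p"
  have p: "p \<in> span B"
    unfolding p_def by (intro span_sum span_scale span_base)
  have rT: "r \<in> T"
    using p \<open>span B \<subseteq> T\<close> t T unfolding r_def by (auto intro: subspace_diff)
  have r: "r \<notin> span B"
    using t p unfolding r_def by (metis diff_add_cancel span_add)
  have orth: "v \<bullet> (P *v r) = 0" if v: "v \<in> B" for v
  proof -
    have "v \<bullet> (P *v p) = (\<Sum>b\<in>B. (b \<bullet> (P *v t)) * (v \<bullet> (P *v b)))"
      unfolding p_def
      by (simp add: linear_sum[OF matrix_vector_mul_linear] matrix_vector_mult_scaleR inner_sum_right)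
    also have "\<dots> = (\<Sum>b\<in>B. if v = b then b \<bullet> (P *v t) else 0)"
      using B v by (intro sum.cong) (auto simp: form_orthonormal_def)
    also have "\<dots> = v \<bullet> (P *v t)"
      using fin v by simp
    finally show ?thesis
      unfolding r_def by (simp add: matrix_vector_mult_diff_distrib inner_diff_right)
  qed
  have "r \<noteq> 0"
    using r span_zero by auto
  then have pos: "r \<bullet> (P *v r) > 0"
    using P by (auto simp: pd_def)
  define s where "s = 1 / sqrt (r \<bullet> (P *v r))"
  have s: "s \<noteq> 0" "s * s * (r \<bullet> (P *v r)) = 1"
    using pos by (auto simp: s_def)
  show ?thesis
  proof
    show "s *\<^sub>R r \<in> T"
      using T rT by (rule subspace_scale)
    show notin: "s *\<^sub>R r \<notin> B"
      using r s span_base span_scale[of "s *\<^sub>R r" B "1 / s"] by auto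
    have "v \<bullet> (P *v (s *\<^sub>R r)) = 0" "(s *\<^sub>R r) \<bullet> (P *v v) = 0" if "v \<in> B" for v
      using orth[OF that] pd_symmetric[OF P, of r v] by (auto simp: matrix_vector_mult_scaleR)
    moreover have "(s *\<^sub>R r) \<bullet> (P *v (s *\<^sub>R r)) = 1"
      using s by (simp add: matrix_vector_mult_scaleR mult.assoc)
    moreover note notin
    ultimately show "form_orthonormal P (insert (s *\<^sub>R r) B)"
      using B(1) unfolding form_orthonormal_def by auto
  qed
qed

text \<open>
  Gram--Schmidt steps can be repeated inside \<open>T\<close> only until the dimension of \<open>T\<close> is exhausted. Starting
  from a prescribed \<open>B\<close> gives bases adapted to a flag of subspaces.
\<close>

lemma form_orthonormal_extend:
  assumes P: "pd P" and T: "subspace T" and B: "form_orthonormal P B" "B \<subseteq> T"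
  obtains B' where "B \<subseteq> B'" "form_orthonormal P B'" "span B' = T"
proof -
  have "\<exists>B'. B \<subseteq> B' \<and> form_orthonormal P B' \<and> span B' = T"
    using B
  proof (induction "dim T - card B" arbitrary: B rule: less_induct)
    case less
    show ?case
    proof (cases "span B = T")
      case True
      with less.prems show ?thesis by blast
    next
      case False
      then obtain b where b: "b \<in> T" "b \<notin> B" "form_orthonormal P (insert b B)"
        using form_orthonormal_insert[OF P T less.prems] by blast
      have fin: "finite B"
        using less.prems(1) form_orthonormal_independent independent_imp_finite by blast
      have "card (insert b B) \<le> dim T"
        using b(1) less.prems(2) form_orthonormal_independent[OF b(3)]
        by (intro independent_card_le_dim) auto
      then have "dim T - card (insert b B) < dim T - card B"
        using fin b by simp
      then obtain B' where "insert b B \<subseteq> B'" "form_orthonormal P B'" "span B' = T"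
        using less.hyps[OF _ b(3)] b(1) less.prems(2) by blast
      then show ?thesis by blast
    qed
  qed
  with that show ?thesis by blast
qed

text \<open>
  The rows of \<open>R\<close> are the members of a \<open>P\<close>-orthonormal basis, so that \<open>R ** P ** transpose R\<close> is its
  Gram matrix. Prescribing some rows serves to adapt \<open>R\<close> to a subspace; with no rows prescribed this
  plays the part of an inverse square root of \<open>P\<close>.
\<close>

lemma pd_congruent_identity:
  fixes P :: "real^'n^'n"
  assumes P: "pd P" and B: "form_orthonormal P B"
  obtains R :: "real^'n^'n"
    where "R ** P ** transpose R = mat 1" "inj (($) R)" "B \<subseteq> range (($) R)"
proof -
  obtain B' where B': "B \<subseteq> B'" "form_orthonormal P B'" "span B' = UNIV"
    using form_orthonormal_extend[OF P subspace_UNIV B] by auto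
  have ind: "independent B'"
    using B' form_orthonormal_independent by blast
  then have "card B' = dim (UNIV :: (real^'n) set)"
    using B' dim_eq_card_independent dim_span by metis
  then have "card B' = card (UNIV :: 'n set)"
    by simp
  then obtain e where e: "bij_betw e (UNIV :: 'n set) B'"
    using finite_same_card_bij[of "UNIV :: 'n set" B'] ind independent_imp_finite by auto
  define R where "R = (\<chi> i. e i)"
  have [simp]: "R $ i = e i" for i
    by (simp add: R_def)
  show ?thesis
  proof
    have "(R ** P ** transpose R) $ i $ j = e i \<bullet> (P *v e j)" for i j
    proof -
      have "(R ** P ** transpose R) $ i $ j = (\<Sum>k\<in>UNIV. (\<Sum>l\<in>UNIV. e i $ l * P $ l $ k) * e j $ k)"
        by (simp add: matrix_matrix_mult_def transpose_def)
      also have "\<dots> = (e i v* P) \<bullet> e j"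
        by (simp add: inner_vec_def vector_matrix_mult_def mult.commute)
      finally show ?thesis
        by (simp add: dot_lmul_matrix)
    qed
    moreover have "e i \<bullet> (P *v e j) = (if i = j then 1 else 0)" for i j
      using B'(2) e by (auto simp: form_orthonormal_def bij_betw_def inj_def)
    ultimately show "R ** P ** transpose R = mat 1"
      by (simp add: vec_eq_iff mat_def)
    show "inj (($) R)" "B \<subseteq> range (($) R)"
      using e B' by (auto simp: bij_betw_def inj_def)
  qed
qed

text \<open>
  For square matrices one-sided inverses are two-sided: \<open>P ** transpose R\<close> is a right inverse of \<open>R\<close>,
  hence also a left one.
\<close>

lemma congruent_identity_inverse:
  fixes P R :: "real^'n^'n"
  assumes "R ** P ** transpose R = mat 1"
  shows "P ** (transpose R ** R) = mat 1" "transpose R ** R ** P = mat 1"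
    "matrix_inv P = transpose R ** R"
proof -
  have "R ** (P ** transpose R) = mat 1"
    using assms by (simp add: matrix_mul_assoc)
  then have "P ** transpose R ** R = mat 1"
    using matrix_left_right_inverse by blast
  then show 1: "P ** (transpose R ** R) = mat 1"
    by (simp add: matrix_mul_assoc)
  then show 2: "transpose R ** R ** P = mat 1"
    using matrix_left_right_inverse by blast
  have "P ** matrix_inv P = mat 1 \<and> matrix_inv P ** P = mat 1"
    unfolding matrix_inv_def by (rule someI[of _ "transpose R ** R"]) (use 1 2 in simp)
  then show "matrix_inv P = transpose R ** R"
    using 2 by (metis matrix_mul_assoc matrix_mul_lid matrix_mul_rid)
qed

section \<open>The covariance bound encoded by the block inequality\<close>

lemma block_matrix_quadratic_form:
  fixes v :: "real^'m" and w :: "real^'n"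
  defines "z \<equiv> (\<chi> i. case i of Inl a \<Rightarrow> v $ a | Inr b \<Rightarrow> w $ b)"
  shows "z \<bullet> (block_matrix P Q R S *v z) = v \<bullet> (P *v v) + v \<bullet> (Q *v w) + w \<bullet> (R *v v) + w \<bullet> (S *v w)"
proof -
  have sum_plus: "(\<Sum>i\<in>UNIV. g i) = (\<Sum>a\<in>UNIV. g (Inl a)) + (\<Sum>b\<in>UNIV. g (Inr b))"
    for g :: "'m + 'n \<Rightarrow> real"
    by (simp add: UNIV_Plus_UNIV[symmetric] sum.Plus del: UNIV_Plus_UNIV)
  show ?thesis
    by (simp add: inner_vec_def matrix_vector_mult_def z_def block_matrix_def sum_plus
      distrib_left sum.distrib)
qed

text \<open>
  This is the inequality \<open>K X K\<^sup>T \<preceq> G\<close>, a Schur complement in which the inverse of \<open>X\<close> is cancelled by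
  \<open>Y = K X\<close>. Testing the block form on the vector \<open>(v, - K\<^sup>T v)\<close> yields it even for singular \<open>X\<close>.
\<close>

lemma psd_block_matrix_bound:
  fixes K :: "real^'n^'m"
  assumes X: "transpose X = X" and psd: "psd (block_matrix G (K ** X) (transpose (K ** X)) X)"
  shows "(transpose K *v v) \<bullet> (X *v (transpose K *v v)) \<le> v \<bullet> (G *v v)"
proof -
  define p where "p = transpose K *v v"
  have cross: "v \<bullet> ((K ** X) *v p) = p \<bullet> (X *v p)"
    by (simp add: p_def matrix_vector_mul_assoc[symmetric] inner_matrix_transpose[of v K])
  moreover have "p \<bullet> (transpose (K ** X) *v v) = v \<bullet> ((K ** X) *v p)"
    by (simp add: inner_matrix_transpose[of v "K ** X"] inner_commute)
  moreover have "0 \<le> v \<bullet> (G *v v) + v \<bullet> ((K ** X) *v (- p)) + (- p) \<bullet> (transpose (K ** X) *v v)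
      + (- p) \<bullet> (X *v (- p))"
    using psd unfolding block_matrix_quadratic_form[symmetric] psd_def by blast
  ultimately show ?thesis
    by (simp add: p_def linear_neg[OF matrix_vector_mul_linear])
qed

lemma psd_diffD: "psd (X - S) \<Longrightarrow> v \<bullet> (S *v v) \<le> v \<bullet> (X *v v)"
  by (simp add: psd_def matrix_vector_mult_diff_rdistrib inner_diff_right)

section \<open>The chance constraint from second moments\<close>

text \<open>
  The quadratic form in \<open>p\<close> is a linear functional of the matrix, so it commutes with the expectation.
\<close>

lemma has_cov_second_moment:
  assumes "has_mean M x 0" "has_cov M x S"
  shows "has_bochner_integral M (\<lambda>\<omega>. (p \<bullet> x \<omega>)\<^sup>2) (p \<bullet> (S *v p))"
proof -
  have "integral\<^sup>L M x = 0"
    using assms by (simp add: has_mean_def has_bochner_integral_integral_eq)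
  then have "has_bochner_integral M (\<lambda>\<omega>. outer (x \<omega>) (x \<omega>)) S"
    using assms by (simp add: has_cov_def)
  moreover have "linear (\<lambda>Z. p \<bullet> (Z *v p))"
    by (auto intro!: linearI simp: matrix_vector_mult_add_rdistrib inner_add_right 
      scaleR_matrix_vector_assoc[symmetric])
  then have "bounded_linear (\<lambda>Z. p \<bullet> (Z *v p))"
    by (simp add: linear_conv_bounded_linear)
  ultimately have "has_bochner_integral M (\<lambda>\<omega>. p \<bullet> (outer (x \<omega>) (x \<omega>) *v p)) (p \<bullet> (S *v p))"
    using has_bochner_integral_bounded_linear by blast
  moreover have "p \<bullet> (outer y y *v p) = (p \<bullet> y)\<^sup>2" for y
    by (simp add: outer_def matrix_vector_mult_def inner_vec_def power2_eq_square sum_distrib_left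
      sum_distrib_right mult_ac)
  ultimately show ?thesis by simp
qed

text \<open>
  With \<open>V F V\<^sup>T = I\<close> and rows \<open>V\<^sub>j\<close> of \<open>V\<close>, the form \<open>u\<^sup>T F\<^bsup>-1\<^esup> u\<close> is the sum of the squares of \<open>V\<^sub>j \<bullet> u\<close>. Each
  has second moment at most \<open>c \<epsilon> / m\<close>, because \<open>V\<^sub>j\<^sup>T F V\<^sub>j = 1\<close>, so the expectation is at most \<open>c \<epsilon>\<close> and Markov's
  inequality applies. This replaces the usual trace argument.
\<close>

lemma wss_chance_constraint:
  fixes K :: "real^'n^'m"
  assumes "prob_space M" and x: "has_mean M x 0" "has_cov M x S" and F: "pd F" and "c > 0"
    and bound: "\<And>v. (transpose K *v v) \<bullet> (S *v (transpose K *v v)) \<le> c * \<epsilon> / real CARD('m) * (v \<bullet> (F *v v))"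
  shows "1 - \<epsilon> \<le> \<P>(\<omega> in M. (K *v x \<omega>) \<bullet> (matrix_inv F *v (K *v x \<omega>)) \<le> c)"
proof -
  interpret prob_space M by fact
  obtain V :: "real^'m^'m" where V: "V ** F ** transpose V = mat 1"
    using pd_congruent_identity[OF F, of "{}"] by auto
  define q where "q \<omega> = (K *v x \<omega>) \<bullet> (matrix_inv F *v (K *v x \<omega>))" for \<omega>
  define p where "p j = transpose K *v (V $ j)" for j
  have q: "q \<omega> = (\<Sum>j\<in>UNIV. (p j \<bullet> x \<omega>)\<^sup>2)" for \<omega>
  proof -
    have "q \<omega> = (V *v (K *v x \<omega>)) \<bullet> (V *v (K *v x \<omega>))"
      unfolding q_def congruent_identity_inverse(3)[OF V]
      by (simp add: inner_matrix_transpose matrix_vector_mul_assoc[symmetric] inner_commute)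
    also have "\<dots> = (\<Sum>j\<in>UNIV. (V $ j \<bullet> (K *v x \<omega>))\<^sup>2)"
      by (simp add: inner_vec_def[of "V *v _"] matrix_vector_mul_component power2_eq_square)
    finally show ?thesis
      by (simp add: p_def inner_matrix_transpose)
  qed
  have V_row: "V $ j \<bullet> (F *v (V $ j)) = 1" for j
  proof -
    have "(V ** F ** transpose V) $ j $ j = (V $ j v* F) \<bullet> V $ j"
      by (simp add: matrix_matrix_mult_def transpose_def vector_matrix_mult_def inner_vec_def mult.commute)
    with V show ?thesis
      by (simp add: dot_lmul_matrix mat_def)
  qed
  have int: "has_bochner_integral M q (\<Sum>j\<in>UNIV. p j \<bullet> (S *v p j))"
    unfolding q using has_cov_second_moment[OF x] by (intro has_bochner_integral_sum) auto
  have "expectation q = (\<Sum>j\<in>UNIV. p j \<bullet> (S *v p j))"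
    using int by (rule has_bochner_integral_integral_eq)
  also have "\<dots> \<le> (\<Sum>j\<in>(UNIV :: 'm set). c * \<epsilon> / real CARD('m))"
    unfolding p_def using bound[of "V $ _"] V_row by (intro sum_mono) simp
  finally have E: "expectation q \<le> c * \<epsilon>"
    by simp
  have qint: "integrable M q"
    using int by (simp add: has_bochner_integral_iff) 
  then have [measurable]: "q \<in> borel_measurable M"
    by simp
  have nonneg: "0 \<le> q \<omega>" for \<omega>
    by (simp add: q sum_nonneg)
  have "prob {\<omega>\<in>space M. q \<omega> > c} \<le> prob {\<omega>\<in>space M. q \<omega> \<ge> c}"
    by (intro finite_measure_mono) auto
  also have "\<dots> \<le> expectation q / c"
    using qint \<open>c > 0\<close> by (intro integral_Markov_inequality_measure[where A = "space M"]) (auto simp: nonneg)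
  also have "\<dots> \<le> \<epsilon>"
    using E \<open>c > 0\<close> by (simp add: divide_le_eq mult.commute)
  finally have "prob {\<omega>\<in>space M. \<not> q \<omega> \<le> c} \<le> \<epsilon>"
    by (simp add: not_le)
  moreover have "prob {\<omega>\<in>space M. \<not> q \<omega> \<le> c} = 1 - prob {\<omega>\<in>space M. q \<omega> \<le> c}"
    by (rule prob_neg) measurable
  ultimately show ?thesis
    by (simp add: q_def)
qed

section \<open>Lebesgue measure under injective linear maps\<close>

text \<open>
  Fubini for functions that are products over the coordinates, indexed by coordinates instead of the
  standard basis vectors.
\<close>

lemma nn_integral_lborel_prod_components:
  fixes f :: "'n::finite \<Rightarrow> real \<Rightarrow> ennreal"
  assumes [measurable]: "\<And>i. f i \<in> borel_measurable borel"
  shows "(\<integral>\<^sup>+v. (\<Prod>i\<in>UNIV. f i (v $ i)) \<partial>lborel) = (\<Prod>i\<in>UNIV. \<integral>\<^sup>+t. f i t \<partial>lborel)"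
proof -
  have inj: "inj (\<lambda>i. axis i (1::real) :: real^'n)"
    by (auto simp: inj_def axis_eq_axis)
  have Basis: "(Basis :: (real^'n) set) = (\<lambda>i. axis i 1) ` UNIV"
    by (auto simp: Basis_vec_def)
  define g where "g b = f (inv (\<lambda>i. axis i (1::real) :: real^'n) b)" for b
  have g: "g (axis i 1) = f i" for i
    using inv_f_f[OF inj] by (simp add: g_def)
  have "(\<integral>\<^sup>+v. (\<Prod>b\<in>Basis. g b (v \<bullet> b)) \<partial>(lborel :: (real^'n) measure)) = (\<Prod>b\<in>(Basis :: (real^'n) set). \<integral>\<^sup>+t. g b t \<partial>lborel)"
    by (rule nn_integral_lborel_prod) (auto simp: g_def)
  then show ?thesis
    unfolding Basis by (simp add: prod.reindex[OF inj] g inner_axis)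
qed

lemma measurable_vec_lambda_PiM [measurable]:
  "(\<lambda>z. \<chi> i. z i) \<in> Pi\<^sub>M (UNIV :: 'n::finite set) (\<lambda>_. lborel) \<rightarrow>\<^sub>M (borel :: (real^'n) measure)"
proof -
  have *: "(\<lambda>z::'n \<Rightarrow> real. \<chi> i. z i) = (\<lambda>z. \<Sum>i\<in>UNIV. z i *\<^sub>R axis i 1)"
    by (auto simp: fun_eq_iff vec_eq_iff axis_def if_distrib sum.delta cong: if_cong)
  have "(\<lambda>z. z i) \<in> borel_measurable (Pi\<^sub>M (UNIV :: 'n::finite set) (\<lambda>_. lborel :: real measure))" for i
    using measurable_component_singleton[of i UNIV "\<lambda>_. lborel :: real measure"] by simp
  then show ?thesis
    unfolding * by (intro borel_measurable_sum borel_measurable_scaleR borel_measurable_const)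
qed

lemma measurable_components_PiM:
  "(\<lambda>(v::real^'n) i. v $ \<sigma> i) \<in> borel \<rightarrow>\<^sub>M Pi\<^sub>M UNIV (\<lambda>_. lborel)"
  by (rule measurable_PiM_single') auto

text \<open>
  Up to the choice of coordinates, Lebesgue measure on \<^typ>\<open>real^'n\<close> is the product of the one-dimensional
  ones: both agree on rectangles. Permuting the coordinates only permutes the factors of a product.
\<close>

lemma distr_lborel_components:
  fixes \<sigma> :: "'n::finite \<Rightarrow> 'n"
  assumes \<sigma>: "bij \<sigma>"
  shows "distr lborel (Pi\<^sub>M UNIV (\<lambda>_. lborel)) (\<lambda>(v::real^'n) i. v $ \<sigma> i) = Pi\<^sub>M UNIV (\<lambda>_. lborel)"
proof -
  interpret product_sigma_finite "\<lambda>_::'n. lborel :: real measure" by standard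
  note measurable_components_PiM[of \<sigma>, measurable]
  show ?thesis
  proof (rule PiM_eqI)
    fix A :: "'n \<Rightarrow> real set"
    assume "\<And>i. i \<in> UNIV \<Longrightarrow> A i \<in> sets lborel"
    then have [measurable]: "A i \<in> sets borel" for i
      by simp
    have "emeasure (distr lborel (Pi\<^sub>M UNIV (\<lambda>_. lborel)) (\<lambda>(v::real^'n) i. v $ \<sigma> i)) (Pi\<^sub>E UNIV A)
        = emeasure lborel {v::real^'n. \<forall>i. v $ \<sigma> i \<in> A i}"
      by (subst emeasure_distr) (auto intro!: sets_PiM_I_finite arg_cong[where f = "emeasure lborel"])
    also have "\<dots> = (\<integral>\<^sup>+v. indicator {v::real^'n. \<forall>i. v $ \<sigma> i \<in> A i} v \<partial>lborel)"
      by (rule nn_integral_indicator[symmetric]) measurable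
    also have "\<dots> = (\<integral>\<^sup>+v. (\<Prod>j\<in>UNIV. indicator (A (inv \<sigma> j)) (v $ j)) \<partial>(lborel :: (real^'n) measure))"
    proof (intro nn_integral_cong)
      fix v :: "real^'n"
      have "(\<Prod>j\<in>UNIV. indicator (A (inv \<sigma> j)) (v $ j)) = (\<Prod>i\<in>UNIV. indicator (A i) (v $ \<sigma> i) :: ennreal)"
        using prod.reindex_bij_betw[OF \<sigma>, of "\<lambda>j. indicator (A (inv \<sigma> j)) (v $ j) :: ennreal"] \<sigma>
        by (simp add: bij_is_inj)
      then show "indicator {v. \<forall>i. v $ \<sigma> i \<in> A i} v = (\<Prod>j\<in>UNIV. indicator (A (inv \<sigma> j)) (v $ j) :: ennreal)"
        by (auto simp: indicator_def)
    qed
    also have "\<dots> = (\<Prod>j\<in>UNIV. \<integral>\<^sup>+t. indicator (A (inv \<sigma> j)) t \<partial>lborel)"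
      by (rule nn_integral_lborel_prod_components) measurable
    also have "\<dots> = (\<Prod>j\<in>UNIV. emeasure lborel (A (inv \<sigma> j)))"
      by simp
    also have "\<dots> = (\<Prod>i\<in>UNIV. emeasure lborel (A i))"
      using prod.reindex_bij_betw[OF bij_imp_bij_inv[OF \<sigma>], of "\<lambda>i. emeasure lborel (A i)"] by simp
    finally show "emeasure (distr lborel (Pi\<^sub>M UNIV (\<lambda>_. lborel)) (\<lambda>(v::real^'n) i. v $ \<sigma> i)) (Pi\<^sub>E UNIV A)
        = (\<Prod>i\<in>UNIV. emeasure lborel (A i))" .
  qed auto
qed

text \<open>
  The right-hand side does not mention \<open>\<sigma>\<close>: this is at once the passage to iterated integrals and the
  invariance under permutations of the coordinates.
\<close>

lemma nn_integral_lborel_permute: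
  fixes g :: "real^'n \<Rightarrow> ennreal" and \<sigma> :: "'n \<Rightarrow> 'n"
  assumes [measurable]: "g \<in> borel_measurable borel" and \<sigma>: "bij \<sigma>"
  shows "(\<integral>\<^sup>+v. g (\<chi> i. v $ \<sigma> i) \<partial>lborel) = (\<integral>\<^sup>+z. g (\<chi> i. z i) \<partial>Pi\<^sub>M UNIV (\<lambda>_. lborel))"
proof -
  have "(\<integral>\<^sup>+z. g (\<chi> i. z i) \<partial>distr lborel (Pi\<^sub>M UNIV (\<lambda>_. lborel)) (\<lambda>v i. v $ \<sigma> i))
      = (\<integral>\<^sup>+v. g (\<chi> i. v $ \<sigma> i) \<partial>lborel)"
    using measurable_components_PiM[of \<sigma>] by (subst nn_integral_distr) auto
  then show ?thesis
    by (simp add: distr_lborel_components[OF \<sigma>])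
qed

lemma nn_integral_lborel_PiM:
  fixes g :: "real^'n \<Rightarrow> ennreal"
  assumes "g \<in> borel_measurable borel"
  shows "(\<integral>\<^sup>+v. g v \<partial>lborel) = (\<integral>\<^sup>+z. g (\<chi> i. z i) \<partial>Pi\<^sub>M UNIV (\<lambda>_. lborel))"
  using nn_integral_lborel_permute[OF assms, of "\<lambda>i. i"] by (simp add: bij_def)

text \<open>
  With all other coordinates fixed, the shear translates the coordinate \<open>m\<close> by a constant, which does not
  change the innermost integral.
\<close>

lemma nn_integral_lborel_shear:
  fixes g :: "real^'n \<Rightarrow> ennreal"
  assumes [measurable]: "g \<in> borel_measurable borel" and mn: "m \<noteq> n"
  shows "(\<integral>\<^sup>+v. g (\<chi> i. if i = m then v $ m + v $ n else v $ i) \<partial>lborel) = (\<integral>\<^sup>+v. g v \<partial>lborel)"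
proof -
  interpret product_sigma_finite "\<lambda>_::'n. lborel :: real measure" by standard
  let ?I = "UNIV - {m}"
  have UNIV: "UNIV = insert m ?I"
    by blast
  have split: "(\<integral>\<^sup>+v. h v \<partial>lborel) = (\<integral>\<^sup>+z. \<integral>\<^sup>+t. h (\<chi> i. (z(m := t)) i) \<partial>lborel \<partial>Pi\<^sub>M ?I (\<lambda>_. lborel))"
    if [measurable]: "h \<in> borel_measurable borel" for h :: "real^'n \<Rightarrow> ennreal"
  proof -
    have "(\<lambda>z. h (\<chi> i. z i)) \<in> borel_measurable (Pi\<^sub>M UNIV (\<lambda>_. lborel))"
      by measurable
    then show ?thesis
      unfolding nn_integral_lborel_PiM[OF that]
      using product_nn_integral_insert[of ?I m "\<lambda>z. h (\<chi> i. z i)"] UNIV by simp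
  qed
  have "continuous_on UNIV (\<lambda>v::real^'n. if i = m then v $ m + v $ n else v $ i)" for i
    by (cases "i = m") (auto intro!: continuous_intros)
  then have "continuous_on UNIV (\<lambda>v::real^'n. \<chi> i. if i = m then v $ m + v $ n else v $ i)"
    by (rule continuous_on_vec_lambda)
  then have [measurable]: "(\<lambda>v::real^'n. \<chi> i. if i = m then v $ m + v $ n else v $ i) \<in> borel \<rightarrow>\<^sub>M borel"
    by (rule borel_measurable_continuous_onI)
  have "(\<integral>\<^sup>+v. g (\<chi> i. if i = m then v $ m + v $ n else v $ i) \<partial>lborel)
      = (\<integral>\<^sup>+z. \<integral>\<^sup>+t. g (\<chi> i. (z(m := z n + t)) i) \<partial>lborel \<partial>Pi\<^sub>M ?I (\<lambda>_. lborel))"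
    using mn by (subst split) (auto intro!: nn_integral_cong arg_cong[where f = g] simp: vec_eq_iff)
  also have "\<dots> = (\<integral>\<^sup>+z. \<integral>\<^sup>+t. g (\<chi> i. (z(m := t)) i) \<partial>lborel \<partial>Pi\<^sub>M ?I (\<lambda>_. lborel))"
  proof (rule nn_integral_cong)
    fix z :: "'n \<Rightarrow> real"
    have "continuous_on UNIV (\<lambda>t. (z(m := t)) i)" for i
      by (cases "i = m") (auto intro!: continuous_intros)
    then have "continuous_on UNIV (\<lambda>t. \<chi> i. (z(m := t)) i)"
      by (rule continuous_on_vec_lambda)
    then have "(\<lambda>t. \<chi> i. (z(m := t)) i) \<in> borel \<rightarrow>\<^sub>M borel"
      by (rule borel_measurable_continuous_onI)
    then have "(\<lambda>t. g (\<chi> i. (z(m := t)) i)) \<in> borel_measurable borel"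
      by measurable
    from nn_integral_real_affine[OF this, of 1 "z n"]
    show "(\<integral>\<^sup>+t. g (\<chi> i. (z(m := z n + t)) i) \<partial>lborel) = (\<integral>\<^sup>+t. g (\<chi> i. (z(m := t)) i) \<partial>lborel)"
      by simp
  qed
  also have "\<dots> = (\<integral>\<^sup>+v. g v \<partial>lborel)"
    by (rule split[symmetric]) measurable
  finally show ?thesis .
qed

text \<open>
  The factor \<open>k\<close> is \<open>1 / \<bar>det f\<bar>\<close>, but its mere existence is enough below: between probability measures it
  is determined by the total mass. It can be found by decomposing \<open>f\<close> into elementary maps, since the
  factors multiply under composition.
\<close>

lemma nn_integral_lborel_linear:
  fixes f :: "real^'n \<Rightarrow> real^'n"
  assumes "linear f" "inj f"
  shows "\<exists>k. \<forall>g\<in>borel_measurable borel. (\<integral>\<^sup>+v. g (f v) \<partial>lborel) = k * (\<integral>\<^sup>+v. g v \<partial>lborel)"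
proof -
  let ?P = "\<lambda>f :: real^'n \<Rightarrow> real^'n. inj f \<longrightarrow> (\<exists>k. \<forall>g\<in>borel_measurable borel.
    (\<integral>\<^sup>+v. g (f v) \<partial>lborel) = k * (\<integral>\<^sup>+v. g v \<partial>lborel))"
  have "?P f"
  proof (rule induct_linear_elementary[OF assms(1), where P = ?P], goal_cases comp zero scale swap shear)
    case (comp f g)
    show ?case
    proof
      assume inj: "inj (f \<circ> g)"
      then have "inj g"
        by (rule inj_on_imageI2)
      then have "surj g"
        using comp(2) linear_injective_imp_surjective by blast
      with inj have "inj f"
        by (metis (no_types, lifting) comp_apply injD injI surj_def)
      obtain k l where k: "\<And>h. h \<in> borel_measurable borel \<Longrightarrow> (\<integral>\<^sup>+v. h (f v) \<partial>lborel) = k * (\<integral>\<^sup>+v. h v \<partial>lborel)"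
        and l: "\<And>h. h \<in> borel_measurable borel \<Longrightarrow> (\<integral>\<^sup>+v. h (g v) \<partial>lborel) = l * (\<integral>\<^sup>+v. h v \<partial>lborel)"
        using comp(3,4) \<open>inj f\<close> \<open>inj g\<close> by blast
      have [measurable]: "f \<in> borel \<rightarrow>\<^sub>M borel"
        using comp(1) by (intro borel_measurable_continuous_onI linear_continuous_on) (simp add: linear_conv_bounded_linear)
      have "(\<integral>\<^sup>+v. h ((f \<circ> g) v) \<partial>lborel) = l * k * (\<integral>\<^sup>+v. h v \<partial>lborel)"
        if [measurable]: "h \<in> borel_measurable borel" for h
        using l[of "\<lambda>v. h (f v)"] k[OF that] by (simp add: mult.assoc)
      then show "\<exists>k. \<forall>h\<in>borel_measurable borel. (\<integral>\<^sup>+v. h ((f \<circ> g) v) \<partial>lborel) = k * (\<integral>\<^sup>+v. h v \<partial>lborel)"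
        by blast
    qed
  next
    case (zero f i)
    have "\<not> surj f"
    proof
      assume "surj f"
      then obtain x where "f x = axis i 1"
        by (metis surjD)
      with zero(2)[of x] show False by simp
    qed
    with zero(1) show ?case
      using linear_injective_imp_surjective by blast
  next
    case (scale c)
    show ?case
    proof
      assume inj: "inj (\<lambda>x. (\<chi> i. c i * x $ i) :: real^'n)"
      have c: "c i \<noteq> 0" for i
      proof
        assume "c i = 0"
        then have "(\<lambda>x. \<chi> i. c i * x $ i) (axis i (1::real)) = (\<lambda>x. \<chi> i. c i * x $ i) (0 :: real^'n)"
          by (auto simp: vec_eq_iff axis_def)
        with inj have "axis i (1::real) = (0 :: real^'n)"
          by (rule injD)
        then show False by simp
      qed
      let ?f = "\<lambda>x. (\<chi> i. c i * x $ i) :: real^'n"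
      let ?k = "ennreal (\<Prod>j\<in>(Basis :: (real^'n) set). \<bar>?f j \<bullet> j\<bar>)"
      have [measurable]: "?f \<in> borel \<rightarrow>\<^sub>M borel"
        by (intro borel_measurable_continuous_onI continuous_on_vec_lambda continuous_intros)
      have nz: "?f j \<bullet> j \<noteq> 0" if "j \<in> Basis" for j
        using that c by (auto simp: Basis_vec_def inner_axis)
      \<comment> \<open>For \<open>j = axis i 1\<close> the factor \<open>?f j \<bullet> j\<close> is \<open>c i\<close>; indexed by basis vectors, the scaling is an
        instance of the affine maps in \<open>lborel_affine_euclidean\<close>.\<close>
      have f: "?f x = 0 + (\<Sum>j\<in>Basis. ((?f j \<bullet> j) * (x \<bullet> j)) *\<^sub>R j)" for x
      proof (rule euclidean_eqI)
        fix b :: "real^'n" assume b: "b \<in> Basis"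
        then have "(\<Sum>j\<in>Basis. ((?f j \<bullet> j) * (x \<bullet> j)) *\<^sub>R j) \<bullet> b = (?f b \<bullet> b) * (x \<bullet> b)"
          by (simp add: inner_sum_left inner_Basis if_distrib sum.delta cong: if_cong)
        also have "\<dots> = ?f x \<bullet> b"
          using b by (auto simp: Basis_vec_def inner_axis)
        finally show "?f x \<bullet> b = (0 + (\<Sum>j\<in>Basis. ((?f j \<bullet> j) * (x \<bullet> j)) *\<^sub>R j)) \<bullet> b"
          by simp
      qed
      have lb: "lborel = density (distr lborel borel ?f) (\<lambda>_. ?k)"
        using lborel_affine_euclidean[of "\<lambda>j. ?f j \<bullet> j" 0, OF nz] unfolding f[symmetric] by simp
      let ?l = "ennreal (1 / (\<Prod>j\<in>(Basis :: (real^'n) set). \<bar>?f j \<bullet> j\<bar>))"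
      have inv: "?l * ?k = 1"
        using nz by (simp add: ennreal_mult'[symmetric] prod_nonneg)
      have "(\<integral>\<^sup>+v. g (?f v) \<partial>lborel) = ?l * (\<integral>\<^sup>+v. g v \<partial>lborel)"
        if [measurable]: "g \<in> borel_measurable borel" for g
      proof -
        have "(\<integral>\<^sup>+v. g v \<partial>lborel) = (\<integral>\<^sup>+v. g v \<partial>density (distr lborel borel ?f) (\<lambda>_. ?k))"
          using lb by simp
        also have "\<dots> = ?k * (\<integral>\<^sup>+v. g (?f v) \<partial>lborel)"
          by (subst nn_integral_density) (auto simp: nn_integral_distr nn_integral_cmult)
        finally have "?l * (\<integral>\<^sup>+v. g v \<partial>lborel) = ?l * ?k * (\<integral>\<^sup>+v. g (?f v) \<partial>lborel)"
          by (simp only: mult.assoc)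
        then show ?thesis
          unfolding inv by simp
      qed
      then show "\<exists>k. \<forall>g\<in>borel_measurable borel. (\<integral>\<^sup>+v. g (?f v) \<partial>lborel) = k * (\<integral>\<^sup>+v. g v \<partial>lborel)"
        by blast
    qed
  next
    case (swap m n)
    have "(\<integral>\<^sup>+v. g (\<chi> i. v $ Transposition.transpose m n i) \<partial>lborel) = 1 * (\<integral>\<^sup>+v. g v \<partial>lborel)"
      if "g \<in> borel_measurable borel" for g :: "real^'n \<Rightarrow> ennreal"
      using nn_integral_lborel_permute[OF that, of "Transposition.transpose m n"]
      by (simp add: nn_integral_lborel_PiM[OF that])
    then show ?case by blast
  next
    case (shear m n)
    then have "(\<integral>\<^sup>+v. g (\<chi> i. if i = m then v $ m + v $ n else v $ i) \<partial>lborel) = 1 * (\<integral>\<^sup>+v. g v \<partial>lborel)"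
      if "g \<in> borel_measurable borel" for g :: "real^'n \<Rightarrow> ennreal"
      using nn_integral_lborel_shear[OF that] by simp
    then show ?case by blast
  qed
  with assms show ?thesis by blast
qed

section \<open>Whitened normal vectors and chi-squared laws\<close>

text \<open>
  In the coordinates \<open>R *v v\<close>, where \<open>R S R\<^sup>T = I\<close>, the exponent is a sum of squares and the density
  factors.
\<close>

lemma mvnormal_density_whitened:
  fixes R S :: "real^'n^'n"
  assumes R: "R ** S ** transpose R = mat 1"
  shows "mvnormal_density 0 S v = 1 / sqrt (det S) * (\<Prod>i\<in>UNIV. std_normal_density ((R *v v) $ i))"
proof -
  have form: "v \<bullet> (matrix_inv S *v v) = (\<Sum>i\<in>UNIV. ((R *v v) $ i)\<^sup>2)"
  proof -
    have "v \<bullet> (matrix_inv S *v v) = (R *v v) \<bullet> (R *v v)"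
      unfolding congruent_identity_inverse(3)[OF R]
      by (simp add: inner_matrix_transpose matrix_vector_mul_assoc[symmetric] inner_commute)
    then show ?thesis
      by (simp add: inner_vec_def power2_eq_square)
  qed
  have "(\<Prod>i\<in>UNIV. std_normal_density ((R *v v) $ i))
      = (\<Prod>i\<in>UNIV. exp (- ((R *v v) $ i)\<^sup>2 / 2) / sqrt (2 * pi))"
    by (simp add: std_normal_density_def)
  also have "\<dots> = exp (\<Sum>i\<in>UNIV. - ((R *v v) $ i)\<^sup>2 / 2) / sqrt (2 * pi) ^ CARD('n)"
    by (simp only: prod_dividef exp_sum[OF finite] prod_constant)
  also have "(\<Sum>i\<in>UNIV. - ((R *v v) $ i)\<^sup>2 / 2) = - (v \<bullet> (matrix_inv S *v v)) / 2"
    by (simp only: form sum_negf sum_divide_distrib[symmetric])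
  finally have "(\<Prod>i\<in>UNIV. std_normal_density ((R *v v) $ i))
      = exp (- (v \<bullet> (matrix_inv S *v v)) / 2) / sqrt (2 * pi) ^ CARD('n)" .
  then show ?thesis
    by (simp only: mvnormal_density_def real_sqrt_mult[of "(2 * pi) ^ CARD('n)"] real_sqrt_power diff_zero) simp
qed

lemma borel_measurable_matrix_vector_nth [measurable]:
  fixes R :: "real^'n^'m"
  assumes "x \<in> borel_measurable M"
  shows "(\<lambda>\<omega>. (R *v x \<omega>) $ i) \<in> borel_measurable M"
  using assms by (simp add: matrix_vector_mul_component)

interpretation std_normal: prob_space std_normal_distribution
  using real_dist_normal_dist by (rule real_distribution.axioms)

text \<open>
  The coordinates of \<open>R *v x\<close> are independent standard normal. On rectangles the two sides agree up to one
  constant \<open>C\<close>, made of the normalization of the density and the Jacobian of \<open>R\<close>; since both are probability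
  measures, \<open>C = 1\<close>.
\<close>

lemma whitened_normal_coordinates:
  fixes R S :: "real^'n^'n"
  assumes M: "prob_space M" and x: "normally_distributed M x 0 S" and R: "R ** S ** transpose R = mat 1"
  shows "distr M (Pi\<^sub>M UNIV (\<lambda>_. std_normal_distribution)) (\<lambda>\<omega> i. (R *v x \<omega>) $ i)
     = Pi\<^sub>M UNIV (\<lambda>_. std_normal_distribution)"
proof -
  interpret prob_space M by fact
  interpret product_sigma_finite "\<lambda>_::'n. std_normal_distribution"
    by standard
  have dist: "distributed M lborel x (\<lambda>v. ennreal (mvnormal_density 0 S v))"
    using x by (simp add: normally_distributed_def)
  then have [measurable]: "x \<in> M \<rightarrow>\<^sub>M borel"
    using distributed_measurable by fastforce
  have [measurable]: "(\<lambda>\<omega> i. (R *v x \<omega>) $ i) \<in> M \<rightarrow>\<^sub>M Pi\<^sub>M UNIV (\<lambda>_. std_normal_distribution)"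
    by (rule measurable_PiM_single') auto
  let ?D = "distr M (Pi\<^sub>M UNIV (\<lambda>_. std_normal_distribution)) (\<lambda>\<omega> i. (R *v x \<omega>) $ i)"
  have "transpose R ** R ** S = mat 1"
    using R by (rule congruent_identity_inverse)
  then have "inj ((*v) R)"
    by (metis matrix_left_invertible_injective matrix_left_right_inverse matrix_mul_assoc)
  then obtain k where k: "\<And>g. g \<in> borel_measurable borel \<Longrightarrow>
      (\<integral>\<^sup>+v. g (R *v v) \<partial>lborel) = k * (\<integral>\<^sup>+v. g v \<partial>lborel)"
    using nn_integral_lborel_linear[OF matrix_vector_mul_linear] by blast
  define C where "C = ennreal (1 / sqrt (det S)) * k"
  have rect: "emeasure ?D (Pi\<^sub>E UNIV A) = C * (\<Prod>i\<in>UNIV. emeasure std_normal_distribution (A i))"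
    if A[measurable]: "\<And>i. A i \<in> sets borel" for A
  proof -
    define g :: "real^'n \<Rightarrow> ennreal"
      where "g y = (\<Prod>i\<in>UNIV. ennreal (std_normal_density (y $ i)) * indicator (A i) (y $ i))" for y
    have [measurable]: "g \<in> borel_measurable borel"
      unfolding g_def by measurable
    have [measurable]: "(\<lambda>v. g (R *v v)) \<in> borel_measurable borel"
      unfolding g_def by measurable
    let ?E = "{v. \<forall>i. (R *v v) $ i \<in> A i}"
    have E: "?E \<in> sets lborel"
      by measurable
    have "emeasure ?D (Pi\<^sub>E UNIV A) = emeasure M (x -` ?E \<inter> space M)"
      by (subst emeasure_distr) (auto intro!: sets_PiM_I_finite arg_cong[where f = "emeasure M"])
    also have "\<dots> = (\<integral>\<^sup>+v. ennreal (mvnormal_density 0 S v) * indicator ?E v \<partial>lborel)"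
      by (rule distributed_emeasure[OF dist E])
    also have "\<dots> = (\<integral>\<^sup>+v. ennreal (1 / sqrt (det S)) * g (R *v v) \<partial>lborel)"
    proof (intro nn_integral_cong)
      fix v
      have "indicator ?E v = (\<Prod>i\<in>UNIV. indicator (A i) ((R *v v) $ i) :: ennreal)"
        by (auto simp: indicator_def)
      then show "ennreal (mvnormal_density 0 S v) * indicator ?E v = ennreal (1 / sqrt (det S)) * g (R *v v)"
        unfolding mvnormal_density_whitened[OF R] g_def
        by (simp only: prod.distrib ennreal_mult''[OF prod_nonneg] prod_ennreal[symmetric]
          normal_density_nonneg mult.assoc ball_simps simp_thms)
    qed
    also have "\<dots> = C * (\<integral>\<^sup>+y. g y \<partial>lborel)"
      by (simp add: nn_integral_cmult k C_def mult.assoc)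
    also have "(\<integral>\<^sup>+y. g y \<partial>lborel) = (\<Prod>i\<in>UNIV. \<integral>\<^sup>+t. ennreal (std_normal_density t) * indicator (A i) t \<partial>lborel)"
      unfolding g_def by (rule nn_integral_lborel_prod_components) measurable
    also have "\<dots> = (\<Prod>i\<in>UNIV. emeasure std_normal_distribution (A i))"
      by (simp add: emeasure_density)
    finally show ?thesis .
  qed
  have "prob_space ?D"
    by (rule prob_space_distr) measurable
  then have "emeasure ?D (Pi\<^sub>E UNIV (\<lambda>_. UNIV)) = 1"
    using prob_space.emeasure_space_1[of ?D] by (simp add: space_PiM)
  moreover have "emeasure std_normal_distribution UNIV = 1"
    using std_normal.emeasure_space_1 by simp
  ultimately have C: "C = 1"
    using rect[of "\<lambda>_. UNIV"] by simp
  show ?thesis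
    by (rule PiM_eqI) (use rect C in auto)
qed

text \<open>
  Marginals of a product measure are products again, and the factors are all equal, so only the number of
  coordinates matters.
\<close>

lemma distr_sum_squares_std_normal:
  assumes "finite I" "J \<subseteq> I"
  shows "distr (Pi\<^sub>M I (\<lambda>_. std_normal_distribution)) borel (\<lambda>z. \<Sum>i\<in>J. (z i)\<^sup>2) = chi_squared (card J)"
proof -
  have "finite J"
    using assms finite_subset by blast
  then obtain h where h: "bij_betw h {..<card J} J"
    using ex_bij_betw_nat_finite atLeast0LessThan by metis
  let ?P = "\<lambda>I. Pi\<^sub>M I (\<lambda>_. std_normal_distribution)"
  have "distr (?P I) (?P {..<card J}) (\<lambda>z. \<lambda>n\<in>{..<card J}. z (h n)) = ?P {..<card J}"
    using h assms std_normal.prob_space_axioms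
    by (intro distr_PiM_reindex) (auto simp: bij_betw_def)
  then have "chi_squared (card J) = distr (distr (?P I) (?P {..<card J}) (\<lambda>z. \<lambda>n\<in>{..<card J}. z (h n))) borel
      (\<lambda>z. \<Sum>i<card J. (z i)\<^sup>2)"
    by (simp add: chi_squared_def)
  also have "\<dots> = distr (?P I) borel ((\<lambda>z. \<Sum>i<card J. (z i)\<^sup>2) \<circ> (\<lambda>z. \<lambda>n\<in>{..<card J}. z (h n)))"
  proof (rule distr_distr)
    show "(\<lambda>z. \<lambda>n\<in>{..<card J}. z (h n)) \<in> ?P I \<rightarrow>\<^sub>M ?P {..<card J}"
      using h assms by (intro measurable_restrict measurable_component_singleton) (auto simp: bij_betw_def)
    have "(\<lambda>z. z i) \<in> borel_measurable (?P {..<card J})" if "i < card J" for i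
      using measurable_component_singleton[of i "{..<card J}" "\<lambda>_. std_normal_distribution"] that by simp
    then show "(\<lambda>z. \<Sum>i<card J. (z i)\<^sup>2) \<in> borel_measurable (?P {..<card J})"
      by (intro borel_measurable_sum borel_measurable_power) auto
  qed
  also have "(\<lambda>z. \<Sum>i<card J. (z i)\<^sup>2) \<circ> (\<lambda>z. \<lambda>n\<in>{..<card J}. z (h n)) = (\<lambda>z. \<Sum>i\<in>J. (z i :: real)\<^sup>2)"
    using sum.reindex_bij_betw[OF h, of "\<lambda>i. (_ i)\<^sup>2"] by (auto simp: fun_eq_iff)
  finally show ?thesis by simp
qed

lemma sum_squares_whitened_chi_squared:
  fixes R S :: "real^'n^'n"
  assumes M: "prob_space M" and x: "normally_distributed M x 0 S" and R: "R ** S ** transpose R = mat 1"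
  shows "distr M borel (\<lambda>\<omega>. \<Sum>i\<in>D. ((R *v x \<omega>) $ i)\<^sup>2) = chi_squared (card D)"
proof -
  let ?P = "Pi\<^sub>M (UNIV :: 'n set) (\<lambda>_. std_normal_distribution)"
  have "x \<in> M \<rightarrow>\<^sub>M lborel"
    using x by (auto simp: normally_distributed_def dest: distributed_measurable)
  then have [measurable]: "x \<in> M \<rightarrow>\<^sub>M borel"
    by simp
  have "chi_squared (card D) = distr (distr M ?P (\<lambda>\<omega> i. (R *v x \<omega>) $ i)) borel (\<lambda>z. \<Sum>i\<in>D. (z i)\<^sup>2)"
    unfolding whitened_normal_coordinates[OF M x R] by (simp add: distr_sum_squares_std_normal)
  also have "\<dots> = distr M borel ((\<lambda>z. \<Sum>i\<in>D. (z i)\<^sup>2) \<circ> (\<lambda>\<omega> i. (R *v x \<omega>) $ i))"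
  proof (rule distr_distr)
    show "(\<lambda>\<omega> i. (R *v x \<omega>) $ i) \<in> M \<rightarrow>\<^sub>M ?P"
      by (rule measurable_PiM_single') auto
    have "(\<lambda>z. z i) \<in> borel_measurable ?P" for i
      using measurable_component_singleton[of i UNIV "\<lambda>_. std_normal_distribution"] by simp
    then show "(\<lambda>z. \<Sum>i\<in>D. (z i)\<^sup>2) \<in> borel_measurable ?P"
      by (intro borel_measurable_sum borel_measurable_power) auto
  qed
  finally show ?thesis
    by (simp add: comp_def)
qed

lemma real_distribution_chi_squared: "real_distribution (chi_squared k)"
proof -
  interpret P: prob_space "Pi\<^sub>M {..<k} (\<lambda>_. std_normal_distribution)"
    by (intro prob_space_PiM std_normal.prob_space_axioms)
  have "(\<lambda>z. z i) \<in> borel_measurable (Pi\<^sub>M {..<k} (\<lambda>_. std_normal_distribution))" if "i < k" for i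
    using measurable_component_singleton[of i "{..<k}" "\<lambda>_. std_normal_distribution"] that by simp
  then have "(\<lambda>z. \<Sum>i<k. (z i)\<^sup>2) \<in> borel_measurable (Pi\<^sub>M {..<k} (\<lambda>_. std_normal_distribution))"
    by (intro borel_measurable_sum borel_measurable_power) auto
  then show ?thesis
    unfolding chi_squared_def by (rule P.real_distribution_distr)
qed

text \<open>
  More degrees of freedom add further nonnegative terms to the sum of squares.
\<close>

lemma cdf_chi_squared_antimono:
  assumes "d \<le> m"
  shows "cdf (chi_squared m) q \<le> cdf (chi_squared d) q"
proof -
  let ?P = "Pi\<^sub>M {..<m} (\<lambda>_. std_normal_distribution)"
  interpret P: prob_space ?P
    by (intro prob_space_PiM std_normal.prob_space_axioms)
  have comp: "(\<lambda>z. z i) \<in> borel_measurable ?P" if "i < m" for i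
    using measurable_component_singleton[of i "{..<m}" "\<lambda>_. std_normal_distribution"] that by simp
  have meas: "(\<lambda>z. \<Sum>i<k. (z i)\<^sup>2) \<in> borel_measurable ?P" if "k \<le> m" for k
    using comp that by (intro borel_measurable_sum borel_measurable_power) auto
  have cdf: "cdf (chi_squared k) q = P.prob {z \<in> space ?P. (\<Sum>i<k. (z i)\<^sup>2) \<le> q}" if "k \<le> m" for k
  proof -
    have "chi_squared k = distr ?P borel (\<lambda>z. \<Sum>i<k. (z i)\<^sup>2)"
      using distr_sum_squares_std_normal[of "{..<m}" "{..<k}"] that by simp
    then show ?thesis
      using meas[OF that]
      by (auto simp: cdf_def measure_distr intro!: arg_cong[where f = P.prob])
  qed
  have "(\<Sum>i<d. (z i)\<^sup>2) \<le> (\<Sum>i<m. (z i)\<^sup>2)" for z :: "nat \<Rightarrow> real"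
    using assms by (intro sum_mono2) auto
  then have "P.prob {z \<in> space ?P. (\<Sum>i<m. (z i)\<^sup>2) \<le> q} \<le> P.prob {z \<in> space ?P. (\<Sum>i<d. (z i)\<^sup>2) \<le> q}"
    using meas[OF assms] by (intro P.finite_measure_mono) (auto intro: order_trans)
  with assms show ?thesis
    by (simp add: cdf)
qed

text \<open>
  On \<^typ>\<open>real^'m\<close> with the standard normal density, the sum of the squared coordinates has this law, and it
  takes the value \<open>t\<close> only on a sphere, which is a Lebesgue null set.
\<close>

lemma chi_squared_no_atoms: "measure (chi_squared CARD('m::finite)) {t} = 0"
proof -
  let ?M = "density lborel (\<lambda>v::real^'m. ennreal (mvnormal_density 0 (mat 1) v))"
  let ?Q = "\<lambda>v::real^'m. \<Sum>i\<in>UNIV. (v $ i)\<^sup>2"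
  have dens: "mvnormal_density 0 (mat 1 :: real^'m^'m) v = (\<Prod>i\<in>UNIV. std_normal_density (v $ i))" for v
    using mvnormal_density_whitened[of "mat 1" "mat 1" v] by (simp add: transpose_mat)
  have [measurable]: "mvnormal_density 0 (mat 1 :: real^'m^'m) \<in> borel_measurable borel"
    unfolding dens by measurable
  have "(\<integral>\<^sup>+t. ennreal (std_normal_density t) \<partial>lborel) = 1"
    using std_normal.emeasure_space_1 by (simp add: emeasure_density)
  then have "emeasure ?M UNIV = 1"
    using nn_integral_lborel_prod_components[of "\<lambda>_::'m. \<lambda>t. ennreal (std_normal_density t)"]
    by (simp add: emeasure_density dens prod_ennreal)
  then have "prob_space ?M"
    by (intro prob_spaceI) simp
  moreover have "pd (mat 1 :: real^'m^'m)"
    by (simp add: pd_def transpose_mat)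
  then have "normally_distributed ?M (\<lambda>v. v) 0 (mat 1)"
    by (simp add: normally_distributed_def distributed_def distr_id2)
  ultimately have "distr ?M borel (\<lambda>v. \<Sum>i\<in>UNIV. ((mat 1 *v v) $ i)\<^sup>2) = chi_squared CARD('m)"
    by (intro sum_squares_whitened_chi_squared[where S = "mat 1"]) (auto simp: transpose_mat)
  then have chi: "chi_squared CARD('m) = distr ?M borel ?Q"
    by simp
  have [measurable]: "?Q \<in> borel_measurable borel"
    by measurable
  have "{v. ?Q v = t} \<subseteq> sphere 0 (sqrt t)"
    by (auto simp: norm_vec_def L2_set_def)
  then have "negligible {v. ?Q v = t}"
    using negligible_sphere negligible_subset by blast
  moreover have S: "{v. ?Q v = t} \<in> sets borel"
    by measurable
  ultimately have "{v. ?Q v = t} \<in> null_sets lborel"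
    by (simp add: negligible_iff_null_sets null_sets_def)
  then have "{v. ?Q v = t} \<in> null_sets ?M"
    using S by (subst null_sets_density_iff) (auto dest: AE_not_in)
  then show ?thesis
    unfolding chi by (simp add: measure_distr vimage_def measure_eq_0_null_sets)
qed

text \<open>
  The distribution function is continuous, as there are no atoms, vanishes at \<open>0\<close> and tends to \<open>1\<close>. By the
  intermediate value theorem \<open>p\<close> is attained on the nonnegative reals, so the quantile is a genuine preimage.
\<close>

lemma chi_squared_quantile:
  assumes "0 < p" "p < 1"
  shows "cdf (chi_squared CARD('m::finite)) (chi_squared_quantile CARD('m) p) = p"
    and "0 < chi_squared_quantile CARD('m) p"
proof -
  let ?c = "cdf (chi_squared CARD('m))"
  interpret real_distribution "chi_squared CARD('m)"
    by (rule real_distribution_chi_squared)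
  have cont: "isCont ?c t" for t
    by (simp add: isCont_cdf chi_squared_no_atoms)
  have c0: "?c 0 = 0"
  proof -
    have "prob {..0} = prob {0}"
    proof (rule finite_measure_eq_AE)
      have "AE t in chi_squared CARD('m). 0 \<le> t"
      proof -
        have "(\<lambda>z. z i) \<in> borel_measurable (Pi\<^sub>M {..<CARD('m)} (\<lambda>_. std_normal_distribution))" if "i < CARD('m)" for i
          using measurable_component_singleton[of i "{..<CARD('m)}" "\<lambda>_. std_normal_distribution"] that by simp
        then show ?thesis
          unfolding chi_squared_def
          by (subst AE_distr_iff) (auto intro!: borel_measurable_sum borel_measurable_power sum_nonneg)
      qed
      then show "AE t in chi_squared CARD('m). (t \<in> {..0}) = (t \<in> {0})"
        by eventually_elim auto
    qed auto
    then show ?thesis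
      by (simp add: cdf_def chi_squared_no_atoms)
  qed
  have "eventually (\<lambda>t. p < ?c t \<and> 0 \<le> t) at_top"
    using order_tendstoD(1)[OF cdf_lim_at_top_prob \<open>p < 1\<close>] eventually_ge_at_top[of 0]
    by (rule eventually_conj)
  then obtain b where b: "p < ?c b" "0 \<le> b"
    using eventually_happens by force
  obtain t where "0 \<le> t" "?c t = p"
    using IVT[of ?c 0 p b] b c0 cont assms by auto
  then have im: "p \<in> ?c ` {0..}"
    by force
  show 1: "?c (chi_squared_quantile CARD('m) p) = p"
    unfolding chi_squared_quantile_def by (rule f_inv_into_f[OF im])
  have "0 \<le> chi_squared_quantile CARD('m) p"
    unfolding chi_squared_quantile_def using inv_into_into[OF im] by simp
  with 1 c0 assms show "0 < chi_squared_quantile CARD('m) p"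
    by (metis less_eq_real_def less_irrefl)
qed

section \<open>The chance constraint for normal states\<close>

text \<open>
  The vectors \<open>K\<^sup>T s\<close> fill a subspace \<open>T\<close> of dimension at most \<open>m\<close>; let the rows of \<open>R\<close> with index in \<open>D\<close> be an
  \<open>S\<close>-orthonormal basis of \<open>T\<close>. With \<open>u = K x\<close> and \<open>s = F\<^bsup>-1\<^esup> u\<close>, the form \<open>Q = u\<^sup>T F\<^bsup>-1\<^esup> u\<close> equals \<open>(K\<^sup>T s) \<bullet> x\<close>, which
  depends only on the coordinates \<open>(R x)\<^sub>i\<close> for \<open>i\<close> in \<open>D\<close>. The squared coefficients of \<open>K\<^sup>T s\<close> in the basis add
  up to \<open>s\<^sup>T K S K\<^sup>T s \<le> a s\<^sup>T F s = a Q\<close>. By Cauchy--Schwarz \<open>Q\<^sup>2 \<le> a Q G\<close>, where \<open>G\<close> is the sum of squares, and \<open>Q\<close>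
  cancels.
\<close>

lemma quadratic_form_le_sum_squares:
  fixes K :: "real^'n^'m" and S :: "real^'n^'n"
  assumes S: "pd S" and F: "pd F" and "0 \<le> a"
    and bound: "\<And>v. (transpose K *v v) \<bullet> (S *v (transpose K *v v)) \<le> a * (v \<bullet> (F *v v))"
  obtains R :: "real^'n^'n" and D where "R ** S ** transpose R = mat 1" "card D \<le> CARD('m)"
    "\<And>x. (K *v x) \<bullet> (matrix_inv F *v (K *v x)) \<le> a * (\<Sum>i\<in>D. ((R *v x) $ i)\<^sup>2)"
proof -
  obtain V :: "real^'m^'m" where V: "V ** F ** transpose V = mat 1"
    using pd_congruent_identity[OF F, of "{}"] by auto
  define T where "T = range ((*v) (transpose K))"
  have T: "subspace T"
    unfolding T_def by (intro linear_subspace_image subspace_UNIV matrix_vector_mul_linear)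
  obtain B where B: "form_orthonormal S B" "span B = T"
    by (rule form_orthonormal_extend[OF S T, of "{}"]) auto
  obtain R :: "real^'n^'n" where R: "R ** S ** transpose R = mat 1" "inj (($) R)" "B \<subseteq> range (($) R)"
    by (rule pd_congruent_identity[OF S B(1)])
  define D where "D = (($) R) -` B"
  have img: "($) R ` D = B"
    using R(3) by (auto simp: D_def)
  have "card B = dim T"
    using B form_orthonormal_independent dim_eq_card_independent dim_span by metis
  moreover have "card D = card B"
    using card_image[of "($) R" D] img R(2) by (metis inj_on_subset subset_UNIV)
  moreover have "dim T \<le> CARD('m)"
    unfolding T_def using dim_image_le[OF matrix_vector_mul_linear, of "transpose K" UNIV] by simp
  ultimately have card: "card D \<le> CARD('m)"
    by simp
  have "(K *v x) \<bullet> (matrix_inv F *v (K *v x)) \<le> a * (\<Sum>i\<in>D. ((R *v x) $ i)\<^sup>2)" for x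
  proof -
    define s where "s = matrix_inv F *v (K *v x)"
    define Q where "Q = (K *v x) \<bullet> s"
    define G where "G = (\<Sum>i\<in>D. ((R *v x) $ i)\<^sup>2)"
    have Fs: "F *v s = K *v x"
      unfolding s_def congruent_identity_inverse(3)[OF V]
      using congruent_identity_inverse(1)[OF V]
      by (metis matrix_vector_mul_assoc matrix_vector_mul_lid)
    have "transpose K *v s \<in> span B"
      using B by (auto simp: T_def)
    moreover have fin: "finite B"
      using B form_orthonormal_independent independent_imp_finite by blast
    ultimately obtain \<beta> where "transpose K *v s = (\<Sum>b\<in>B. \<beta> b *\<^sub>R b)"
      by (auto simp: span_finite)
    then have Ks: "transpose K *v s = (\<Sum>i\<in>D. \<beta> (R $ i) *\<^sub>R R $ i)"
      using sum.reindex[of "($) R" D "\<lambda>b. \<beta> b *\<^sub>R b"] R(2) img by (simp add: inj_on_subset comp_def)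
    have Q1: "Q = (\<Sum>i\<in>D. \<beta> (R $ i) * (R *v x) $ i)"
    proof -
      have "Q = (transpose K *v s) \<bullet> x"
        unfolding Q_def using inner_matrix_transpose[of s K x] by (simp add: inner_commute)
      then show ?thesis
        unfolding Ks by (simp add: inner_sum_left matrix_vector_mul_component)
    qed
    have orth: "R $ i \<bullet> (S *v (R $ j)) = (if i = j then 1 else 0)" if "i \<in> D" "j \<in> D" for i j
      using that B(1) R(2) unfolding form_orthonormal_def D_def by (auto dest: injD)
    have "(transpose K *v s) \<bullet> (S *v (transpose K *v s))
       = (\<Sum>i\<in>D. \<Sum>j\<in>D. \<beta> (R $ i) * \<beta> (R $ j) * (R $ j \<bullet> (S *v (R $ i))))"
      unfolding Ks by (simp add: linear_sum[OF matrix_vector_mul_linear] matrix_vector_mult_scaleR 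
        inner_sum_left inner_sum_right sum_distrib_left mult_ac)
    also have "\<dots> = (\<Sum>i\<in>D. \<Sum>j\<in>D. if i = j then (\<beta> (R $ i))\<^sup>2 else 0)"
      by (intro sum.cong refl) (auto simp: orth power2_eq_square)
    also have "\<dots> = (\<Sum>i\<in>D. (\<beta> (R $ i))\<^sup>2)"
      by simp
    finally have beta: "(\<Sum>i\<in>D. (\<beta> (R $ i))\<^sup>2) \<le> a * Q"
      using bound[of s] by (simp add: Fs Q_def inner_commute)
    have "Q\<^sup>2 \<le> (\<Sum>i\<in>D. (\<beta> (R $ i))\<^sup>2) * G"
      unfolding Q1 G_def by (rule Cauchy_Schwarz_ineq_sum)
    also have "\<dots> \<le> a * Q * G"
      using beta by (intro mult_right_mono) (auto simp: G_def sum_nonneg)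
    finally have sq: "Q * Q \<le> Q * (a * G)"
      by (simp add: power2_eq_square mult_ac)
    have "Q \<le> a * G"
    proof (cases "Q > 0")
      case True
      with sq show ?thesis by simp
    next
      case False
      moreover have "0 \<le> a * G"
        using \<open>0 \<le> a\<close> by (simp add: G_def sum_nonneg)
      ultimately show ?thesis by simp
    qed
    then show ?thesis
      by (simp add: Q_def s_def G_def)
  qed
  with R(1) card that show ?thesis by blast
qed

text \<open>
  The form is at most \<open>c / q\<close> times a chi-squared variable with \<open>d \<le> m\<close> degrees of freedom, \<open>q\<close> being the
  quantile for \<open>m\<close>. It therefore stays below \<open>c\<close> whenever that variable stays below \<open>q\<close>. Possibly \<open>d < m\<close>, when
  \<open>K\<close> does not have full row rank.
\<close>

lemma nrm_chance_constraint:
  fixes K :: "real^'n^'m"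
  assumes M: "prob_space M" and x: "normally_distributed M x 0 S" and F: "pd F" and "c > 0"
    and \<epsilon>: "0 < \<epsilon>" "\<epsilon> < 1"
    and bound: "\<And>v. (transpose K *v v) \<bullet> (S *v (transpose K *v v))
      \<le> c / chi_squared_quantile CARD('m) (1 - \<epsilon>) * (v \<bullet> (F *v v))"
  shows "1 - \<epsilon> \<le> \<P>(\<omega> in M. (K *v x \<omega>) \<bullet> (matrix_inv F *v (K *v x \<omega>)) \<le> c)"
proof -
  interpret prob_space M by fact
  define q where "q = chi_squared_quantile CARD('m) (1 - \<epsilon>)"
  have q: "0 < q" "cdf (chi_squared CARD('m)) q = 1 - \<epsilon>"
    using chi_squared_quantile[of "1 - \<epsilon>", where 'm = 'm] \<epsilon> by (simp_all add: q_def)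
  have S: "pd S"
    using x by (simp add: normally_distributed_def)
  have [measurable]: "x \<in> M \<rightarrow>\<^sub>M borel"
    using x by (auto simp: normally_distributed_def dest: distributed_measurable)
  have a: "0 \<le> c / q"
    using q \<open>c > 0\<close> by simp
  obtain R :: "real^'n^'n" and D where R: "R ** S ** transpose R = mat 1" and D: "card D \<le> CARD('m)"
    and le: "\<And>y. (K *v y) \<bullet> (matrix_inv F *v (K *v y)) \<le> c / q * (\<Sum>i\<in>D. ((R *v y) $ i)\<^sup>2)"
    using quadratic_form_le_sum_squares[OF S F a bound[folded q_def]] by metis
  define G where "G \<omega> = (\<Sum>i\<in>D. ((R *v x \<omega>) $ i)\<^sup>2)" for \<omega>
  have [measurable]: "G \<in> borel_measurable M"
    unfolding G_def by measurable
  have chi: "distr M borel G = chi_squared (card D)"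
    unfolding G_def by (rule sum_squares_whitened_chi_squared[OF M x R])
  have "1 - \<epsilon> = cdf (chi_squared CARD('m)) q"
    using q by simp
  also have "\<dots> \<le> cdf (chi_squared (card D)) q"
    by (rule cdf_chi_squared_antimono[OF D])
  also have "\<dots> = prob {\<omega> \<in> space M. G \<omega> \<le> q}"
    unfolding chi[symmetric] cdf_def
    by (subst measure_distr) (auto intro!: arg_cong[where f = prob])
  also have "\<dots> \<le> \<P>(\<omega> in M. (K *v x \<omega>) \<bullet> (matrix_inv F *v (K *v x \<omega>)) \<le> c)"
  proof (rule finite_measure_mono)
    have "(K *v x \<omega>) \<bullet> (matrix_inv F *v (K *v x \<omega>)) \<le> c" if "G \<omega> \<le> q" for \<omega>
    proof -
      have "c / q * G \<omega> \<le> c / q * q"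
        using that a by (rule mult_left_mono)
      with le[of "x \<omega>"] q show ?thesis
        by (simp add: G_def)
    qed
    then show "{\<omega> \<in> space M. G \<omega> \<le> q}
        \<subseteq> {\<omega> \<in> space M. (K *v x \<omega>) \<bullet> (matrix_inv F *v (K *v x \<omega>)) \<le> c}"
      by blast
    have "(\<lambda>\<omega>. (K *v x \<omega>) \<bullet> (matrix_inv F *v (K *v x \<omega>))) \<in> borel_measurable M"
      unfolding inner_vec_def inner_real_def matrix_vector_mul_assoc by measurable
    then show "{\<omega> \<in> space M. (K *v x \<omega>) \<bullet> (matrix_inv F *v (K *v x \<omega>)) \<le> c} \<in> sets M"
      by measurable
  qed
  finally show ?thesis .
qed

theorem lemma10:
  fixes A :: "real^'n^'n" and B :: "real^'m^'n" and W :: "real^'n^'n"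
    and K :: "real^'n^'m" and F :: "real^'m^'m"
    and X Xbar :: "real^'n^'n" and Y :: "real^'n^'m"
    and c \<epsilon> :: real
    and N :: "'w measure" and w :: "nat \<Rightarrow> 'w \<Rightarrow> real^'n"
    and M :: "'s measure" and x :: "'s \<Rightarrow> real^'n" and u :: "'s \<Rightarrow> real^'m"
  assumes "stabilizable A B"
    and "strictly_stabilizing A B K"
    and "pd W"
    and "Xbar = stationary_cov A B W K"
    and "prob_space N"
    and "prob_space M"
    and "u = (\<lambda>\<omega>. K *v x \<omega>)"
    and "pd F"
    and "0 < c"
    and "0 < \<epsilon>" and "\<epsilon> < 1"
    and "transpose X = X"
    and "psd (X - Xbar)"
    and "Y = K ** X"
  shows "(wss_disturbance N w W \<and> has_mean M x 0 \<and> has_cov M x Xbar \<and>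
          psd (block_matrix ((c * \<epsilon> / real CARD('m)) *\<^sub>R F) Y (transpose Y) X)
          \<longrightarrow> \<P>(\<omega> in M. u \<omega> \<bullet> (matrix_inv F *v u \<omega>) \<le> c) \<ge> 1 - \<epsilon>) \<and>
         (nrm_disturbance N w W \<and> normally_distributed M x 0 Xbar \<and>
          psd (block_matrix ((c / chi_squared_quantile CARD('m) (1 - \<epsilon>)) *\<^sub>R F) Y (transpose Y) X)
          \<longrightarrow> \<P>(\<omega> in M. u \<omega> \<bullet> (matrix_inv F *v u \<omega>) \<le> c) \<ge> 1 - \<epsilon>)"
proof -
  have bound: "(transpose K *v v) \<bullet> (Xbar *v (transpose K *v v)) \<le> a * (v \<bullet> (F *v v))"
    if "psd (block_matrix (a *\<^sub>R F) Y (transpose Y) X)" for a v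
  proof -
    have "(transpose K *v v) \<bullet> (Xbar *v (transpose K *v v)) \<le> (transpose K *v v) \<bullet> (X *v (transpose K *v v))"
      using \<open>psd (X - Xbar)\<close> by (rule psd_diffD)
    also have "\<dots> \<le> v \<bullet> ((a *\<^sub>R F) *v v)"
      using \<open>transpose X = X\<close> that unfolding \<open>Y = K ** X\<close> by (rule psd_block_matrix_bound)
    finally show ?thesis
      by (simp add: scaleR_matrix_vector_assoc[symmetric])
  qed
  show ?thesis
    unfolding \<open>u = (\<lambda>\<omega>. K *v x \<omega>)\<close>
    using wss_chance_constraint[OF \<open>prob_space M\<close> _ _ \<open>pd F\<close> \<open>0 < c\<close> bound]
      nrm_chance_constraint[OF \<open>prob_space M\<close> _ \<open>pd F\<close> \<open>0 < c\<close> \<open>0 < \<epsilon>\<close> \<open>\<epsilon> < 1\<close> bound]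
    by blast
qed

end
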